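(* Let $I=\{1,\dots,n\}$ with $n\ge 2$, let $A$ be a finite set with $|A|\ge 2$, and let $G$ be a strategic game with player set $I$, common action set $A$ and payoff functions $\pi_i:A^I\to\mathbb{R}$ ($i\in I$). The following two definitions of "$G$ is anonymous" are equivalent: (1) there exist functions $u^i_a:P_{n-1}\to\mathbb{R}$ (for $i\in I$, $a\in A$) such that $\pi_i(\mathbf{a})=u^i_{a_i}(\#\mathbf{a}_{-i})$ for all $i\in I$ and all $\mathbf{a}\in A^I$; (2) for all $i\in I$ and all $\mathbf{a},\mathbf{b}\in A^I$, if $a_i=b_i$ and $\#\mathbf{a}_{-i}=\#\mathbf{b}_{-i}$, then $\pi_i(\mathbf{a})=\pi_i(\mathbf{b})$.
   Context: A profile is an element $\mathbf{a}=(a_1,\dots,a_n)\in A^I$; $\mathbf{a}_{-i}$ is the vector obtained by deleting the $i$-th coordinate. For a vector $\mathbf{x}$ with entries in $A$, $\#\mathbf{x}=(\#(a,\mathbf{x}))_{a\in A}$, where $\#(a,\mathbf{x})$ is the number of coordinates of $\mathbf{x}$ equal to $a$. $P_{n-1}=\{(x_a)_{a\in A}: x_a\in\mathbb{N}\ (0\in\mathbb{N}),\ \sum_{a\in A}x_a=n-1\}=\{\#\mathbf{a}_{-i}:\mathbf{a}\in A^I\}$. *)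

theory Defs
  imports Complex_Main "HOL-Library.FuncSet"
begin

text \<open>
  Vectors over a set of actions are extensional functions on their set of coordinates, so
  the set \<open>A^I\<close> of profiles of the game with player set \<open>I = {1..n}\<close> is \<open>{1..n} \<rightarrow>\<^sub>E A\<close>.
  Payoffs \<open>\<pi> i\<close> are total HOL functions that are only ever evaluated at profiles.
\<close>

definition profiles :: "nat \<Rightarrow> 'a set \<Rightarrow> (nat \<Rightarrow> 'a) set" where
  "profiles n A = {1..n} \<rightarrow>\<^sub>E A"

text \<open>
  \<open>a\<^sub>-\<^sub>i\<close> keeps the original player labels: its set of coordinates is \<open>{1..n} - {i}\<close>.
\<close>

definition delete_coord :: "nat \<Rightarrow> nat \<Rightarrow> (nat \<Rightarrow> 'a) \<Rightarrow> (nat \<Rightarrow> 'a)" where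
  "delete_coord n i a = restrict a ({1..n} - {i})"

text \<open>
  The vector \<open>#x\<close>, indexed by \<open>A\<close>, of a vector \<open>x\<close> with set of coordinates \<open>J\<close>.  The set
  \<open>J\<close> is an explicit argument because it cannot be read off from the HOL function \<open>x\<close>.
\<close>

definition count_vec :: "'a set \<Rightarrow> nat set \<Rightarrow> (nat \<Rightarrow> 'a) \<Rightarrow> ('a \<Rightarrow> nat)" where
  "count_vec A J x = (\<lambda>c\<in>A. card {j \<in> J. x j = c})"

definition count_others :: "nat \<Rightarrow> 'a set \<Rightarrow> nat \<Rightarrow> (nat \<Rightarrow> 'a) \<Rightarrow> ('a \<Rightarrow> nat)" where
  "count_others n A i a = count_vec A ({1..n} - {i}) (delete_coord n i a)"

definition count_space :: "'a set \<Rightarrow> nat \<Rightarrow> ('a \<Rightarrow> nat) set" where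
  "count_space A m = {x \<in> A \<rightarrow>\<^sub>E UNIV. (\<Sum>c\<in>A. x c) = m}"

text \<open>
  The function spaces \<open>\<rightarrow>\<^sub>E UNIV\<close> make the domain of each \<open>u i c\<close> exactly \<open>P\<^sub>n\<^sub>-\<^sub>1\<close>: off it,
  \<open>u i c\<close> takes the fixed value \<open>undefined\<close> and carries no information.
\<close>

definition anonymous_by_representation ::
  "nat \<Rightarrow> 'a set \<Rightarrow> (nat \<Rightarrow> (nat \<Rightarrow> 'a) \<Rightarrow> real) \<Rightarrow> bool" where
  "anonymous_by_representation n A \<pi> \<longleftrightarrow>
     (\<exists>u :: nat \<Rightarrow> 'a \<Rightarrow> ('a \<Rightarrow> nat) \<Rightarrow> real.
        (\<forall>i\<in>{1..n}. \<forall>c\<in>A. u i c \<in> count_space A (n - 1) \<rightarrow>\<^sub>E UNIV) \<and>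
        (\<forall>i\<in>{1..n}. \<forall>a\<in>profiles n A. \<pi> i a = u i (a i) (count_others n A i a)))"

definition anonymous_by_invariance ::
  "nat \<Rightarrow> 'a set \<Rightarrow> (nat \<Rightarrow> (nat \<Rightarrow> 'a) \<Rightarrow> real) \<Rightarrow> bool" where
  "anonymous_by_invariance n A \<pi> \<longleftrightarrow>
     (\<forall>i\<in>{1..n}. \<forall>a\<in>profiles n A. \<forall>b\<in>profiles n A.
        a i = b i \<and> count_others n A i a = count_others n A i b \<longrightarrow> \<pi> i a = \<pi> i b)"

end

theory Submission
  imports Defs
begin

text \<open>
  Invariance says precisely that, for each player \<open>i\<close>, the payoff \<open>\<pi> i\<close> is constant on the
  fibres of the map sending a profile \<open>a\<close> to the pair of \<open>a i\<close> and the counts of the other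
  players' actions; representability says that \<open>\<pi> i\<close> factors through this map. A function
  factors through a map exactly when it is constant on its fibres, and the factor is obtained
  by evaluating \<open>\<pi> i\<close> at a representative of each fibre. Off the image of the map the factor
  may be arbitrary. Since \<open>u i c\<close> is \<open>undefined\<close> off the simplex of counts of total \<open>n - 1\<close>,
  there is one thing to verify: counts of the opponents of a player do lie in that simplex.
\<close>

text \<open>
  The fibres of \<open>x\<close> over the actions partition the set of coordinates, so their sizes add up
  to its cardinality.
\<close>

lemma count_vec_in_count_space:
  assumes "finite A" and "finite J" and "x \<in> J \<rightarrow> A"
  shows "count_vec A J x \<in> count_space A (card J)"
proof -
  have "(\<Sum>c\<in>A. card {j \<in> J. x j = c}) = (\<Sum>c\<in>A. \<Sum>j\<in>{j \<in> J. x j = c}. 1)"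
    by simp
  also have "\<dots> = (\<Sum>j\<in>J. 1)"
    using assms by (intro sum.group) auto
  finally show ?thesis
    by (simp add: count_vec_def count_space_def)
qed

lemma count_others_in_count_space:
  assumes "finite A" and "i \<in> {1..n}" and "a \<in> profiles n A"
  shows "count_others n A i a \<in> count_space A (n - 1)"
proof -
  have "delete_coord n i a \<in> {1..n} - {i} \<rightarrow> A"
    using assms(3) by (auto simp: delete_coord_def profiles_def)
  then have "count_others n A i a \<in> count_space A (card ({1..n} - {i}))"
    unfolding count_others_def using assms(1) by (intro count_vec_in_count_space) auto
  then show ?thesis
    using assms(2) by simp
qed

theorem proposition2p13:
  fixes n :: nat
    and A :: "'a set"
    and \<pi> :: "nat \<Rightarrow> (nat \<Rightarrow> 'a) \<Rightarrow> real"
  assumes "n \<ge> 2"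
    and "finite A"
    and "card A \<ge> 2"
  shows "anonymous_by_representation n A \<pi> \<longleftrightarrow> anonymous_by_invariance n A \<pi>"
proof
  assume "anonymous_by_representation n A \<pi>"
  then obtain u :: "nat \<Rightarrow> 'a \<Rightarrow> ('a \<Rightarrow> nat) \<Rightarrow> real" where
    u: "\<And>i a. i \<in> {1..n} \<Longrightarrow> a \<in> profiles n A \<Longrightarrow> \<pi> i a = u i (a i) (count_others n A i a)"
    unfolding anonymous_by_representation_def by blast
  then show "anonymous_by_invariance n A \<pi>"
    by (simp add: anonymous_by_invariance_def)
next
  assume inv: "anonymous_by_invariance n A \<pi>"
  define rep where
    "rep i c x = (SOME b. b \<in> profiles n A \<and> b i = c \<and> count_others n A i b = x)" for i c x
  define u where "u i c = (\<lambda>x\<in>count_space A (n - 1). \<pi> i (rep i c x))" for i c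
  have "\<pi> i a = u i (a i) (count_others n A i a)"
    if i: "i \<in> {1..n}" and a: "a \<in> profiles n A" for i a
  proof -
    let ?b = "rep i (a i) (count_others n A i a)"
    \<comment> \<open>The fibre is nonempty, as it contains \<open>a\<close>, so its chosen representative belongs to it.\<close>
    have "?b \<in> profiles n A \<and> ?b i = a i \<and> count_others n A i ?b = count_others n A i a"
      unfolding rep_def by (rule someI[of _ a]) (simp add: a)
    then have "\<pi> i a = \<pi> i ?b"
      using inv i a unfolding anonymous_by_invariance_def by metis
    then show ?thesis
      using count_others_in_count_space[OF assms(2) i a] by (simp add: u_def)
  qed
  moreover have "u i c \<in> count_space A (n - 1) \<rightarrow>\<^sub>E UNIV" for i c
    by (simp add: u_def)
  ultimately show "anonymous_by_representation n A \<pi>"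
    unfolding anonymous_by_representation_def by blast
qed

end
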